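(* Let $\widehat{K}_{3,4}'$ be the graph obtained from $\widehat{K}_{3,4}$ by deleting any one edge incident to the vertex $u$. Then $\widehat{K}_{3,4}'\notin\mathfrak{N}$.
   Context: All graphs are finite, without loops or multiple edges. An interval $t$-coloring of a graph $H$ is a proper edge-coloring of $H$ with colors $1,\ldots,t$ such that every color is used and for every vertex $v$ the set of colors of edges incident to $v$ is an interval of integers. $\mathfrak{N}$ denotes the set of graphs having an interval $t$-coloring for some positive integer $t$. $K_{3,4}$ is the complete bipartite graph with parts of sizes $3$ and $4$. For a graph $G$, $\widehat{G}$ is the graph obtained by subdividing every edge $v_iv_j$ of $G$ with a new vertex $w_{ij}$ (replacing $v_iv_j$ by $v_iw_{ij},v_jw_{ij}$) and then adding a new vertex $u$ adjacent to all the subdivision vertices $w_{ij}$. In $\widehat{K}_{3,4}$ the vertex $u$ has degree $12$, so $\widehat{K}_{3,4}'$ has $20$ vertices and maximum degree $11$. *)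

theory Defs
  imports Main
begin

record 'a ugraph =
  verts :: "'a set"
  edges :: "'a set set"

definition simple_graph :: "'a ugraph \<Rightarrow> bool" where
  "simple_graph G \<longleftrightarrow> finite (verts G) \<and> (\<forall>e\<in>edges G. e \<subseteq> verts G \<and> card e = 2)"

definition incident_edges :: "'a ugraph \<Rightarrow> 'a \<Rightarrow> 'a set set" where
  "incident_edges G v = {e \<in> edges G. v \<in> e}"

definition delete_edge :: "'a ugraph \<Rightarrow> 'a set \<Rightarrow> 'a ugraph" where
  "delete_edge G e = G\<lparr>edges := edges G - {e}\<rparr>"

definition proper_edge_coloring :: "'a ugraph \<Rightarrow> ('a set \<Rightarrow> nat) \<Rightarrow> bool" where
  "proper_edge_coloring G c \<longleftrightarrow>
     (\<forall>e\<in>edges G. \<forall>f\<in>edges G. e \<noteq> f \<and> e \<inter> f \<noteq> {} \<longrightarrow> c e \<noteq> c f)"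

text \<open>The colors are \<open>1, \<dots>, t\<close>, each of them used. At an isolated vertex the set of colors is the
  empty interval (\<open>a > b\<close>).\<close>

definition interval_coloring :: "'a ugraph \<Rightarrow> nat \<Rightarrow> ('a set \<Rightarrow> nat) \<Rightarrow> bool" where
  "interval_coloring G t c \<longleftrightarrow>
     proper_edge_coloring G c \<and>
     c ` edges G = {1..t} \<and>
     (\<forall>v\<in>verts G. \<exists>a b. c ` incident_edges G v = {a..b})"

definition interval_colorable_graphs :: "'a ugraph set" ("\<NN>") where
  "\<NN> = {G. simple_graph G \<and> (\<exists>t\<ge>1. \<exists>c. interval_coloring G t c)}"

definition complete_bipartite :: "nat \<Rightarrow> nat \<Rightarrow> (nat + nat) ugraph" where
  "complete_bipartite m n =
     \<lparr>verts = Inl ` {..<m} \<union> Inr ` {..<n},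
      edges = {{Inl i, Inr j} |i j. i < m \<and> j < n}\<rparr>"

text \<open>\<open>Sub e\<close> is the new vertex subdividing the edge \<open>e\<close>, and \<open>Apex\<close> is the vertex \<open>u\<close>.\<close>

datatype 'a hat_vertex = Orig 'a | Sub "'a set" | Apex

definition hat :: "'a ugraph \<Rightarrow> 'a hat_vertex ugraph" where
  "hat G =
     \<lparr>verts = Orig ` verts G \<union> Sub ` edges G \<union> {Apex},
      edges = {{Orig v, Sub e} |v e. e \<in> edges G \<and> v \<in> e} \<union> {{Apex, Sub e} |e. e \<in> edges G}\<rparr>"

text \<open>Membership in \<open>\<NN>\<close> includes being a simple graph; the following facts show that this
  condition holds for the graphs constructed above, so that it is never the reason for
  non-membership.\<close>

lemma simple_graph_complete_bipartite: "simple_graph (complete_bipartite m n)"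
  by (auto simp: simple_graph_def complete_bipartite_def)

lemma finite_edges: "simple_graph G \<Longrightarrow> finite (edges G)"
  by (rule finite_subset[of _ "Pow (verts G)"]) (auto simp: simple_graph_def)

lemma simple_graph_hat: "simple_graph G \<Longrightarrow> simple_graph (hat G)"
  using finite_edges[of G] by (auto simp: simple_graph_def hat_def)

lemma simple_graph_delete_edge: "simple_graph G \<Longrightarrow> simple_graph (delete_edge G e)"
  by (auto simp: simple_graph_def delete_edge_def)

lemma card_edges_complete_bipartite: "card (edges (complete_bipartite m n)) = m * n"
proof -
  have "edges (complete_bipartite m n) = (\<lambda>(i, j). {Inl i, Inr j}) ` ({..<m} \<times> {..<n})"
    by (auto simp: complete_bipartite_def)
  moreover have "inj_on (\<lambda>(i, j). {Inl i, Inr j} :: (nat + nat) set) ({..<m} \<times> {..<n})"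
    by (auto simp: inj_on_def doubleton_eq_iff)
  ultimately show ?thesis by (simp add: card_image)
qed

lemma card_verts_hat_K34: "card (verts (hat (complete_bipartite 3 4))) = 20"
proof -
  let ?K = "complete_bipartite 3 4"
  have fin: "finite (verts ?K)" "finite (edges ?K)"
    using simple_graph_complete_bipartite[of 3 4] finite_edges[of ?K]
    by (auto simp: simple_graph_def)
  have "card (verts ?K) = 7"
    by (simp add: complete_bipartite_def card_Plus flip: Plus_def)
  then have "card (Orig ` verts ?K) = 7" "card (Sub ` edges ?K) = 12"
    by (simp_all add: card_image inj_on_def card_edges_complete_bipartite)
  moreover have "card (Orig ` verts ?K \<union> Sub ` edges ?K) = card (Orig ` verts ?K) + card (Sub ` edges ?K)"
    using fin by (intro card_Un_disjoint) auto
  moreover have "verts (hat ?K) = insert Apex (Orig ` verts ?K \<union> Sub ` edges ?K)"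
    by (simp add: hat_def)
  moreover have "Apex \<notin> Orig ` verts ?K \<union> Sub ` edges ?K" by auto
  ultimately show ?thesis using fin by simp
qed

lemma card_incident_edges_Apex: "card (incident_edges (hat G) Apex) = card (edges G)"
proof -
  have "incident_edges (hat G) Apex = (\<lambda>e. {Apex, Sub e}) ` edges G"
    by (auto simp: incident_edges_def hat_def)
  moreover have "inj_on (\<lambda>e. {Apex, Sub e}) (edges G)"
    by (auto simp: inj_on_def doubleton_eq_iff)
  ultimately show ?thesis by (simp add: card_image)
qed

end

theory Submission
  imports Defs
begin

text \<open>
  Label the cell \<open>(i, j)\<close> of a \<open>3 \<times> 4\<close> array by the colors \<open>X\<close>, \<open>P\<close>, \<open>Q\<close> of the edges joining
  \<open>w\<^sub>i\<^sub>j\<close> to \<open>u\<close>, to \<open>v\<^sub>i\<close> and to \<open>v\<^sub>j\<close>, shifted so that \<open>X\<close> takes exactly the values \<open>0, \<dots>, 10\<close>.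
  Labels of one cell differ by at most 2, the values of \<open>P\<close> in a row by at most 3 and the values of
  \<open>Q\<close> in a column by at most 2. Hence the cells with \<open>X = 0\<close> and \<open>X = 10\<close> share no row and no
  column, and the two routes between them through the opposite corners of the rectangle they span
  are so tight that all labels in its four corners are forced. In the remaining row \<open>c\<close>, the value
  \<open>X = 9\<close> then forces the values of \<open>P\<close> to be \<open>4, 5, 6, 7\<close>, while by reflection \<open>X = 1\<close> forces
  them to be \<open>3, 4, 5, 6\<close>.
\<close>

section \<open>Labelled 3 by 4 arrays\<close>

locale cell_labelling =
  fixes A :: "'a set" and B :: "'b set" and D :: "'a \<times> 'b" and X P Q :: "'a \<Rightarrow> 'b \<Rightarrow> int"
  assumes card_A: "card A = 3" and card_B: "card B = 4"
    and row: "\<lbrakk>i \<in> A; j \<in> B; j' \<in> B; j \<noteq> j'\<rbrakk> \<Longrightarrow> P i j \<noteq> P i j' \<and> P i j \<le> P i j' + 3"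
    and col: "\<lbrakk>i \<in> A; i' \<in> A; j \<in> B; i \<noteq> i'\<rbrakk> \<Longrightarrow> Q i j \<noteq> Q i' j \<and> Q i j \<le> Q i' j + 2"
    and PQ: "\<lbrakk>i \<in> A; j \<in> B\<rbrakk> \<Longrightarrow> P i j \<noteq> Q i j \<and> \<bar>P i j - Q i j\<bar> \<le> 2"
    and XPQ: "\<lbrakk>i \<in> A; j \<in> B; (i, j) \<noteq> D\<rbrakk> \<Longrightarrow>
      X i j \<noteq> P i j \<and> X i j \<noteq> Q i j \<and> \<bar>X i j - P i j\<bar> \<le> 2 \<and> \<bar>X i j - Q i j\<bar> \<le> 2"
    and PQ_deleted: "\<lbrakk>i \<in> A; j \<in> B; (i, j) = D\<rbrakk> \<Longrightarrow> \<bar>P i j - Q i j\<bar> = 1"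
    and X_inj: "\<lbrakk>i \<in> A; j \<in> B; i' \<in> A; j' \<in> B; (i, j) \<noteq> D; (i', j') \<noteq> D; X i j = X i' j'\<rbrakk>
      \<Longrightarrow> i = i' \<and> j = j'"
    and X_surj: "\<lbrakk>0 \<le> n; n \<le> 10\<rbrakk> \<Longrightarrow> \<exists>i\<in>A. \<exists>j\<in>B. (i, j) \<noteq> D \<and> X i j = n"
begin

text \<open>The conditions only compare labels with one another, apart from the range of
  \<open>X\<close>, and \<open>0..10\<close> is symmetric about 5. Reflection thus exchanges the
  cells with \<open>X = 0\<close> and \<open>X = 10\<close>.\<close>

lemma reflected: "cell_labelling A B D (\<lambda>i j. 10 - X i j) (\<lambda>i j. 10 - P i j) (\<lambda>i j. 10 - Q i j)"
proof (unfold_locales, goal_cases)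
  case (3 i j j')
  then show ?case using row[of i j' j] by auto
next
  case (4 i i' j)
  then show ?case using col[of i' i j] by auto
next
  case (5 i j)
  then show ?case using PQ[of i j] by auto
next
  case (6 i j)
  then show ?case using XPQ[of i j] by auto
next
  case (7 i j)
  then show ?case using PQ_deleted[of i j] by auto
next
  case (8 i j i' j')
  then show ?case using X_inj[of i j i' j'] by auto
next
  case (9 n)
  then show ?case using X_surj[of "10 - n"] by force
qed (rule card_A card_B)+

text \<open>Adding the row, column and cell bounds along both routes from \<open>(a, b)\<close> to
  \<open>(a', b')\<close> gives \<open>P a' b' + Q a' b' \<le> P a b + Q a b + 14\<close>. The left
  side is at least 17 and the right side at most 17, so every bound used is an equality.\<close>

lemma extreme_corners:
  assumes mem: "a \<in> A" "a' \<in> A" "b \<in> B" "b' \<in> B"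
    and nD: "(a, b) \<noteq> D" "(a', b') \<noteq> D" and X: "X a b = 0" "X a' b' = 10"
  shows "a \<noteq> a'" "b \<noteq> b'"
    and "P a b = 2 \<and> Q a b = 1 \<and> P a b' = 5 \<and> Q a b' = 7 \<and> X a b' = 6 \<and> (a, b') \<noteq> D"
    and "P a' b' = 8 \<and> Q a' b' = 9 \<and> P a' b = 5 \<and> Q a' b = 3 \<and> X a' b = 4 \<and> (a', b) \<noteq> D"
proof -
  \<comment> \<open>Since \<open>P\<close> and \<open>Q\<close> differ on a cell, both cannot be 2
    here, nor both 8 at the other end; hence the sums 3 and 17 instead of 4 and 16.\<close>
  have lo: "P a b \<le> 2" "Q a b \<le> 2" "P a b + Q a b \<le> 3"
    using XPQ[OF mem(1,3) nD(1)] PQ[OF mem(1,3)] X by linarith+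
  have hi: "8 \<le> P a' b'" "8 \<le> Q a' b'" "17 \<le> P a' b' + Q a' b'"
    using XPQ[OF mem(2,4) nD(2)] PQ[OF mem(2,4)] X by linarith+
  show "a \<noteq> a'"
  proof
    assume "a = a'"
    moreover from this have "b \<noteq> b'"
      using X by auto
    ultimately show False
      using row[of a b' b] mem lo hi by auto
  qed
  show "b \<noteq> b'"
    using col[of a' a b] \<open>a \<noteq> a'\<close> mem lo hi by auto
  note ne = \<open>a \<noteq> a'\<close> \<open>b \<noteq> b'\<close>
  have r: "P a b' \<le> P a b + 3" "P a' b' \<le> P a' b + 3"
    using row[of a b' b] row[of a' b' b] mem ne by auto
  have c: "Q a' b' \<le> Q a b' + 2" "Q a' b \<le> Q a b + 2"
    using col[of a' a b'] col[of a' a b] mem ne by auto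
  have pq: "Q a b' - P a b' \<le> 2" "P a' b - Q a' b \<le> 2"
    using PQ[of a b'] PQ[of a' b] mem by auto
  have tight: "Q a b' = P a b' + 2" "P a' b = Q a' b + 2"
    using lo(3) hi(3) r c pq by linarith+
  \<comment> \<open>The deleted cell would need \<open>P\<close> and \<open>Q\<close> to differ by
    1, but here they differ by 2; so \<open>X\<close> is constrained too and must be their
    midpoint.\<close>
  have nD': "(a, b') \<noteq> D" "(a', b) \<noteq> D"
    using PQ_deleted[of a b'] PQ_deleted[of a' b] mem tight by auto
  have Xmid: "X a b' = P a b' + 1"
    using XPQ[OF mem(1,4) nD'(1)] tight(1) by linarith
  have Xmid': "X a' b = Q a' b + 1"
    using XPQ[OF mem(2,3) nD'(2)] tight(2) by linarith
  have Pa: "P a b' = P a b + 3" "Q a' b = Q a b + 2" "P a b + Q a b = 3"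
    using lo(3) hi(3) r c tight by linarith+
  \<comment> \<open>With \<open>p = P a b\<close> these two values are \<open>p + 4\<close> and
    \<open>6 - p\<close>, which agree exactly when \<open>p = 1\<close>.\<close>
  have "X a b' \<noteq> X a' b"
    using X_inj[of a b' a' b] mem ne nD' by auto
  then have "P a b \<noteq> 1"
    using Pa Xmid Xmid' by auto
  then have "P a b = 2"
    using lo Pa(3) by linarith
  then show "P a b = 2 \<and> Q a b = 1 \<and> P a b' = 5 \<and> Q a b' = 7 \<and> X a b' = 6 \<and> (a, b') \<noteq> D"
    using Pa tight Xmid nD' by auto
  show "P a' b' = 8 \<and> Q a' b' = 9 \<and> P a' b = 5 \<and> Q a' b = 3 \<and> X a' b = 4 \<and> (a', b) \<noteq> D"
    using \<open>P a b = 2\<close> Pa tight Xmid' nD' r c hi by auto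
qed

text \<open>The corners confine \<open>P\<close> on row \<open>c\<close> to \<open>3..7\<close>.
  Going through the possible positions of \<open>X = 9\<close> shows that 7 is attained there, which
  leaves \<open>P c b = 4\<close> because the spread is at most 3.\<close>

lemma nine_forces_row:
  assumes A: "A = {a, a', c}" and B: "B = {b, b', d, d'}"
    and dist: "distinct [a, a', c]" "distinct [b, b', d, d']"
    and nD: "(a, b) \<noteq> D" "(a', b') \<noteq> D" and X: "X a b = 0" "X a' b' = 10"
  shows "P c b = 4 \<and> (\<exists>j\<in>B. P c j = 7)"
proof -
  have mem: "a \<in> A" "a' \<in> A" "c \<in> A" "b \<in> B" "b' \<in> B" "d \<in> B" "d' \<in> B"
    using A B by auto
  note corners = extreme_corners(3,4)[OF mem(1,2,4,5) nD X]
  \<comment> \<open>In column \<open>b\<close> the corners have \<open>Q\<close> equal to 1 and 3,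
    in column \<open>b'\<close> 7 and 9, so row \<open>c\<close> takes the middle value. Then
    \<open>P c b \<le> 4\<close> and \<open>P c b' \<ge> 6\<close>, and these may differ by at most
    3.\<close>
  have Pc: "P c b \<in> {3, 4}" "P c b' \<in> {6, 7}" "P c b' \<le> P c b + 3" and Qc: "Q c b = 2" "Q c b' = 8"
  proof -
    show "Q c b = 2" "Q c b' = 8"
      using corners col[of c a b] col[of c a' b] col[of a' c b]
        col[of c a b'] col[of a c b'] col[of a' c b'] dist mem by auto
    then show "P c b \<in> {3, 4}" "P c b' \<in> {6, 7}" "P c b' \<le> P c b + 3"
      using PQ[of c b] PQ[of c b'] row[of c b' b] dist mem by auto
  qed
  \<comment> \<open>\<open>P\<close> takes the values 2 and 5 in row \<open>a\<close>, and 5 and 8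
    in row \<open>a'\<close>: the full spread of 3, so the other cells lie strictly between.\<close>
  have other: "P a j \<in> {3, 4}" "P a' j \<in> {6, 7}" "3 \<le> P c j" "P c j \<le> 7" "P c j \<noteq> P c b" "P c j \<noteq> P c b'"
    if "j \<in> {d, d'}" for j
  proof -
    have j: "j \<in> B" "j \<noteq> b" "j \<noteq> b'"
      using that B dist by auto
    show "P a j \<in> {3, 4}"
      using corners row[of a j b] row[of a b' j] row[of a j b'] j mem by auto
    show "P a' j \<in> {6, 7}"
      using corners row[of a' j b] row[of a' b' j] row[of a' j b'] j mem by auto
    show "3 \<le> P c j" "P c j \<le> 7" "P c j \<noteq> P c b" "P c j \<noteq> P c b'"
      using Pc row[of c j b] row[of c b' j] row[of c j b'] j mem by auto
  qed
  obtain i j where ij: "i \<in> A" "j \<in> B" "(i, j) \<noteq> D" "X i j = 9"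
    using X_surj[of 9] by auto
  note cell = XPQ[OF ij(1-3)] PQ[OF ij(1,2)]
  consider "i \<in> {a, a'}" "j \<in> {b, b'}" | "i = a" "j \<in> {d, d'}" | "i = a'" "j \<in> {d, d'}"
    | "i = c" "j = b" | "i = c" "j = b'" | "i = c" "j \<in> {d, d'}"
    using ij A B by auto
  then show ?thesis
  proof cases
    case 1
    then show ?thesis using ij X corners by auto
  next
    case 2
    then show ?thesis using other[of j] cell ij by auto
  next
    \<comment> \<open>The only surviving position outside row \<open>c\<close>. Its effect passes
      down column \<open>j\<close>, where \<open>Q\<close> must be 6, 7, 8 in rows \<open>a\<close>,
      \<open>c\<close>, \<open>a'\<close>, so \<open>P c j\<close> is 5 or 6.\<close>
    case 3
    have a': "P a' j = 7" "Q a' j = 8"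
      using 3 other[of j] cell ij(4) by auto
    have "Q a j = 6"
      using a' col[of a' a j] other(1)[of j] PQ[of a j] 3 dist mem ij(2) by auto
    then have Q: "Q c j = 7"
      using a' col[of a' c j] col[of c a j] 3 dist mem ij(2) by auto
    \<comment> \<open>The value 5 would put \<open>X c j\<close> at the midpoint 6, already taken by
      \<open>X a b'\<close>.\<close>
    have "P c j \<noteq> 5"
    proof
      assume five: "P c j = 5"
      then have "(c, j) \<noteq> D"
        using PQ_deleted[of c j] Q mem ij(2) by auto
      moreover from this have "X c j = 6"
        using XPQ[of c j] five Q mem ij(2) by auto
      ultimately show False
        using X_inj[of c j a b'] corners dist mem ij(2) by auto
    qed
    then have "P c j = 6"
      using Q other[of j] 3 PQ[of c j] mem ij(2) by auto
    \<comment> \<open>With 6 used up in row \<open>c\<close>, only \<open>P c b' = 7\<close>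
      remains.\<close>
    then show ?thesis
      using other(6)[of j] 3 Pc mem by auto
  next
    case 4
    then show ?thesis using Pc cell ij by auto
  next
    case 5
    then show ?thesis using Pc Qc cell ij mem by auto
  next
    case 6
    then have "P c j = 7"
      using other[of j] cell ij by auto
    moreover have "P c j \<le> P c b + 3"
      using row[of c j b] 6 dist mem ij(2) by auto
    ultimately show ?thesis
      using Pc ij(2) by auto
  qed
qed

lemma contradictory: False
proof -
  obtain a b where ab: "a \<in> A" "b \<in> B" "(a, b) \<noteq> D" "X a b = 0"
    using X_surj[of 0] by auto
  obtain a' b' where ab': "a' \<in> A" "b' \<in> B" "(a', b') \<noteq> D" "X a' b' = 10"
    using X_surj[of 10] by auto
  have ne: "a \<noteq> a'" "b \<noteq> b'"
    using extreme_corners(1,2) ab ab' by blast+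
  have fin: "finite A" "finite B"
    using card_A card_B card.infinite by fastforce+
  have "card (A - {a, a'}) = 1" "card (B - {b, b'}) = 2"
    using ab ab' ne fin card_A card_B by (simp_all add: card_Diff_subset)
  then obtain c d d' where "A - {a, a'} = {c}" "B - {b, b'} = {d, d'}" "d \<noteq> d'"
    by (metis card_1_singletonE card_2_iff)
  then have A: "A = {a, a', c}" "A = {a', a, c}" and B: "B = {b, b', d, d'}" "B = {b', b, d, d'}"
    and dist: "distinct [a, a', c]" "distinct [b, b', d, d']"
      "distinct [a', a, c]" "distinct [b', b, d, d']"
    using ab ab' ne by auto
  interpret R: cell_labelling A B D "\<lambda>i j. 10 - X i j" "\<lambda>i j. 10 - P i j" "\<lambda>i j. 10 - Q i j"
    by (rule reflected)
  obtain j where j: "j \<in> B" "P c j = 7"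
    using nine_forces_row[OF A(1) B(1) dist(1,2)] ab ab' by auto
  \<comment> \<open>A reflected 7 is a 3, so row \<open>c\<close> contains both 3 and 7, one more
    than the allowed spread.\<close>
  obtain j' where j': "j' \<in> B" "P c j' = 3"
    using R.nine_forces_row[OF A(2) B(2) dist(3,4)] ab ab' by auto
  show False
    using row[of c j j'] j j' A(1) by (cases "j = j'") auto
qed

end

section \<open>Colors at a single vertex\<close>

lemma interval_coloring_inj_on:
  assumes "interval_coloring G t c"
  shows "inj_on c (incident_edges G v)"
  using assms unfolding interval_coloring_def proper_edge_coloring_def incident_edges_def inj_on_def
  by blast

lemma interval_coloring_image:
  assumes "interval_coloring G t c" "v \<in> verts G" "card (incident_edges G v) = Suc k"
  shows "\<exists>m. c ` incident_edges G v = {m..m + k}"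
proof -
  obtain m n where mn: "c ` incident_edges G v = {m..n}"
    using assms unfolding interval_coloring_def by blast
  have "card {m..n} = Suc k"
    using card_image[OF interval_coloring_inj_on[OF assms(1), of v]] mn assms(3) by simp
  then have "n = m + k"
    by auto
  then show ?thesis using mn by blast
qed

text \<open>A vertex of degree \<open>d\<close> sees \<open>d\<close> consecutive colors, which
  differ by at most \<open>d - 1\<close>. Bounding the degree by a superset \<open>S\<close> treats
  subdivision vertices of degree 2 and 3 alike.\<close>

lemma interval_coloring_adjacent:
  assumes col: "interval_coloring G t c" and v: "v \<in> verts G"
    and ef: "e \<in> edges G" "f \<in> edges G" "v \<in> e" "v \<in> f" "e \<noteq> f"
    and deg: "incident_edges G v \<subseteq> S" "finite S" "card S \<le> Suc k"
  shows "c e \<noteq> c f \<and> \<bar>int (c e) - int (c f)\<bar> \<le> int k"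
proof -
  have mem: "e \<in> incident_edges G v" "f \<in> incident_edges G v"
    using ef by (auto simp: incident_edges_def)
  have fin: "finite (incident_edges G v)"
    using deg finite_subset by blast
  then obtain l where l: "card (incident_edges G v) = Suc l"
    using mem by (metis card_gt_0_iff empty_iff gr0_implies_Suc)
  then have "l \<le> k"
    using card_mono[OF deg(2,1)] deg(3) by linarith
  moreover obtain m where "c ` incident_edges G v = {m..m + l}"
    using interval_coloring_image[OF col v l] by blast
  then have "c e \<in> {m..m + l}" "c f \<in> {m..m + l}"
    using mem by blast+
  moreover have "c e \<noteq> c f"
    using interval_coloring_inj_on[OF col] mem ef(5) by (meson inj_onD)
  ultimately show ?thesis by auto
qed

section \<open>The graph with one edge at \<open>Apex\<close> deleted\<close>

lemma doubleton_Inl_Inr_eq_iff [simp]: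
  "{Inl i, Inr j} = {Inl i', Inr j'} \<longleftrightarrow> i = i' \<and> j = j'"
  by (auto simp: doubleton_eq_iff)

lemma doubleton_Apex_Sub_eq_iff [simp]: "{Apex, Sub e} = {Apex, Sub f} \<longleftrightarrow> e = f"
  by (auto simp: doubleton_eq_iff)

lemma doubleton_Orig_Sub_neq_Apex [simp]: "{Orig v, Sub e} \<noteq> {Apex, f}"
  by (auto simp: doubleton_eq_iff)

lemma Collect_diff_singleton:
  assumes "\<And>i j. f i j = f r s \<longleftrightarrow> i = r \<and> j = s"
  shows "{f i j |i j. R i \<and> S j} - {f r s} = {f i j |i j. R i \<and> S j \<and> (i, j) \<noteq> (r, s)}"
  using assms by auto

lemma card_le_Suc_intros:
  "card {x, y} \<le> Suc 1" "card {x, y, z} \<le> Suc 2"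
  using card_insert_le_m1[of 3 "{y, z}" x] by (auto simp: card_insert_if)

context
  fixes r s t :: nat and c :: "(nat + nat) hat_vertex set \<Rightarrow> nat" and H
  assumes rs: "r < 3" "s < 4"
    and H: "H = delete_edge (hat (complete_bipartite 3 4)) {Apex, Sub {Inl r, Inr s}}"
    and col: "interval_coloring H t c"
begin

abbreviation w :: "nat \<Rightarrow> nat \<Rightarrow> (nat + nat) hat_vertex" where
  "w i j \<equiv> Sub {Inl i, Inr j}"

lemma edges_H:
  "edges H = {{Orig (Inl i), w i j} |i j. i < 3 \<and> j < 4} \<union> {{Orig (Inr j), w i j} |i j. i < 3 \<and> j < 4}
     \<union> {{Apex, w i j} |i j. i < 3 \<and> j < 4 \<and> (i, j) \<noteq> (r, s)}"
proof -
  have "edges (hat (complete_bipartite 3 4)) =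
    {{Orig (Inl i), w i j} |i j. i < 3 \<and> j < 4} \<union> {{Orig (Inr j), w i j} |i j. i < 3 \<and> j < 4}
      \<union> {{Apex, w i j} |i j. i < 3 \<and> j < 4}"
    (is "_ = ?L \<union> ?R \<union> ?U")
    unfolding hat_def complete_bipartite_def by (simp only: ugraph.simps) blast
  moreover have "?L - {{Apex, w r s}} = ?L" "?R - {{Apex, w r s}} = ?R"
    by auto
  moreover have "?U - {{Apex, w r s}} = {{Apex, w i j} |i j. i < 3 \<and> j < 4 \<and> (i, j) \<noteq> (r, s)}"
    by (rule Collect_diff_singleton) simp
  ultimately show ?thesis
    by (simp add: H delete_edge_def Un_Diff)
qed

lemma verts_H:
  "Apex \<in> verts H" "i < 3 \<Longrightarrow> Orig (Inl i) \<in> verts H" "j < 4 \<Longrightarrow> Orig (Inr j) \<in> verts H"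
  "i < 3 \<Longrightarrow> j < 4 \<Longrightarrow> w i j \<in> verts H"
  unfolding H delete_edge_def hat_def complete_bipartite_def by auto

lemma incident_Inl: "incident_edges H (Orig (Inl i)) \<subseteq> (\<lambda>j. {Orig (Inl i), w i j}) ` {..<4}"
  by (auto simp: incident_edges_def edges_H)

lemma incident_Inr: "incident_edges H (Orig (Inr j)) \<subseteq> (\<lambda>i. {Orig (Inr j), w i j}) ` {..<3}"
  by (auto simp: incident_edges_def edges_H)

text \<open>The second inclusion records the deletion: \<open>w r s\<close> has only two edges left,
  whose colors must therefore be consecutive.\<close>

lemma incident_Sub:
  "incident_edges H (w i j) \<subseteq> {{Orig (Inl i), w i j}, {Orig (Inr j), w i j}, {Apex, w i j}}"
  "incident_edges H (w r s) \<subseteq> {{Orig (Inl r), w r s}, {Orig (Inr s), w r s}}"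
  unfolding incident_edges_def edges_H
  by (rule subsetI, elim CollectE conjE UnE exE; simp)+

text \<open>An equality is needed here, since the exact degree 11 fixes the set of colors at
  \<open>Apex\<close> and makes \<open>X\<close> attain all of \<open>0..10\<close>.\<close>

lemma incident_Apex:
  "incident_edges H Apex = (\<lambda>(i, j). {Apex, w i j}) ` ({..<3} \<times> {..<4} - {(r, s)})"
proof -
  have "incident_edges H Apex = {{Apex, w i j} |i j. i < 3 \<and> j < 4 \<and> (i, j) \<noteq> (r, s)}"
    by (auto simp: incident_edges_def edges_H simp del: doubleton_Apex_Sub_eq_iff)
  also have "\<dots> = (\<lambda>(i, j). {Apex, w i j}) ` ({..<3} \<times> {..<4} - {(r, s)})"
    by force
  finally show ?thesis .
qed

lemma card_incident_Apex: "card (incident_edges H Apex) = Suc 10"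
proof -
  have "inj_on (\<lambda>(i, j). {Apex, w i j}) ({..<3} \<times> {..<4} - {(r, s)})"
    by (rule inj_onI) (simp split: prod.splits)
  then have "card (incident_edges H Apex) = card ({..<3::nat} \<times> {..<4::nat} - {(r, s)})"
    unfolding incident_Apex by (rule card_image)
  also have "\<dots> = Suc 10"
    using rs by (subst card_Diff_subset) auto
  finally show ?thesis .
qed

text \<open>The spreads 3, 2 and 2 are one less than the degree bounds 4, 3 and 3 at row, column and
  subdivision vertices. Labels are integers because colors below \<open>m\<close> may occur away
  from \<open>Apex\<close>.\<close>

lemma cell_labelling_of_coloring:
  assumes m: "c ` incident_edges H Apex = {m..m + 10}"
  shows "cell_labelling {..<3} {..<4} (r, s) (\<lambda>i j. int (c {Apex, w i j}) - int m)
    (\<lambda>i j. int (c {Orig (Inl i), w i j}) - int m) (\<lambda>i j. int (c {Orig (Inr j), w i j}) - int m)"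
proof (unfold_locales, goal_cases)
  case (3 i j j')
  have "c {Orig (Inl i), w i j} \<noteq> c {Orig (Inl i), w i j'} \<and>
    \<bar>int (c {Orig (Inl i), w i j}) - int (c {Orig (Inl i), w i j'})\<bar> \<le> int 3"
    using 3 card_image_le[of "{..<4::nat}"]
    by (intro interval_coloring_adjacent[OF col verts_H(2)[of i] _ _ _ _ _ incident_Inl])
      (auto simp: edges_H doubleton_eq_iff)
  then show ?case by auto
next
  case (4 i i' j)
  have "c {Orig (Inr j), w i j} \<noteq> c {Orig (Inr j), w i' j} \<and>
    \<bar>int (c {Orig (Inr j), w i j}) - int (c {Orig (Inr j), w i' j})\<bar> \<le> int 2"
    using 4 card_image_le[of "{..<3::nat}"]
    by (intro interval_coloring_adjacent[OF col verts_H(3)[of j] _ _ _ _ _ incident_Inr])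
      (auto simp: edges_H doubleton_eq_iff)
  then show ?case by auto
next
  case (5 i j)
  have "c {Orig (Inl i), w i j} \<noteq> c {Orig (Inr j), w i j} \<and>
    \<bar>int (c {Orig (Inl i), w i j}) - int (c {Orig (Inr j), w i j})\<bar> \<le> int 2"
    using 5
    by (intro interval_coloring_adjacent[OF col verts_H(4)[of i j] _ _ _ _ _ incident_Sub(1)]
        card_le_Suc_intros) (auto simp: edges_H doubleton_eq_iff)
  then show ?case by auto
next
  case (6 i j)
  have "c {Apex, w i j} \<noteq> c {Orig (Inl i), w i j} \<and>
    \<bar>int (c {Apex, w i j}) - int (c {Orig (Inl i), w i j})\<bar> \<le> int 2"
    using 6
    by (intro interval_coloring_adjacent[OF col verts_H(4)[of i j] _ _ _ _ _ incident_Sub(1)]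
        card_le_Suc_intros) (auto simp: edges_H doubleton_eq_iff)
  moreover have "c {Apex, w i j} \<noteq> c {Orig (Inr j), w i j} \<and>
    \<bar>int (c {Apex, w i j}) - int (c {Orig (Inr j), w i j})\<bar> \<le> int 2"
    using 6
    by (intro interval_coloring_adjacent[OF col verts_H(4)[of i j] _ _ _ _ _ incident_Sub(1)]
        card_le_Suc_intros) (auto simp: edges_H doubleton_eq_iff)
  ultimately show ?case by auto
next
  case (7 i j)
  have "c {Orig (Inl r), w r s} \<noteq> c {Orig (Inr s), w r s} \<and>
    \<bar>int (c {Orig (Inl r), w r s}) - int (c {Orig (Inr s), w r s})\<bar> \<le> int 1"
    using rs
    by (intro interval_coloring_adjacent[OF col verts_H(4)[of r s] _ _ _ _ _ incident_Sub(2)]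
        card_le_Suc_intros) (auto simp: edges_H doubleton_eq_iff)
  then show ?case using 7 by auto
next
  case (8 i j i' j')
  then have "{Apex, w i j} = {Apex, w i' j'}"
    by (intro inj_onD[OF interval_coloring_inj_on[OF col, of Apex]]) (auto simp: incident_Apex)
  then show ?case by (auto simp: doubleton_eq_iff)
next
  case (9 n)
  then have "m + nat n \<in> c ` incident_edges H Apex"
    by (auto simp: m)
  then obtain k where k: "k \<in> {..<3} \<times> {..<4} - {(r, s)}"
    "m + nat n = c (case k of (i, j) \<Rightarrow> {Apex, w i j})"
    unfolding incident_Apex by blast
  obtain i j where ij: "k = (i, j)"
    by (cases k)
  then have "int (c {Apex, w i j}) - int m = n"
    using k(2) 9 by simp
  moreover have "i \<in> {..<3}" "j \<in> {..<4}" "(i, j) \<noteq> (r, s)"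
    using k(1) ij by simp_all
  ultimately show ?case by blast
qed auto

lemma no_interval_coloring: False
proof -
  obtain m where "c ` incident_edges H Apex = {m..m + 10}"
    using interval_coloring_image[OF col verts_H(1) card_incident_Apex] by (elim exE)
  then show False
    by (rule cell_labelling.contradictory[OF cell_labelling_of_coloring])
qed

end

theorem theorem13:
  assumes "e \<in> incident_edges (hat (complete_bipartite 3 4)) Apex"
  shows "delete_edge (hat (complete_bipartite 3 4)) e \<notin> \<NN>"
proof -
  obtain r s where "r < 3" "s < 4" "e = {Apex, Sub {Inl r, Inr s}}"
    using assms by (auto simp: incident_edges_def hat_def complete_bipartite_def)
  then have "\<not> interval_coloring (delete_edge (hat (complete_bipartite 3 4)) e) t c" for t c
    using no_interval_coloring[OF _ _ refl] by (intro notI) simp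
  then show ?thesis
    by (simp add: interval_colorable_graphs_def)
qed

end
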